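(* Let $\mathcal{A}=(A,\cdot,\ast,\alpha)$ be a Hom-pre-Lie Poisson algebra over $\mathbb{K}$. For any $x,y\in A$, let $\{x,y\}=x\ast y-y\ast x$. Then $\mathcal{A}^c=(A,\cdot,\{\cdot,\cdot\},\alpha)$ is a transposed Hom-Poisson algebra (called the sub-adjacent transposed Hom-Poisson algebra of $(A,\cdot,\ast,\alpha)$).
   Context: $\mathbb{K}$ is an algebraically closed field of characteristic $0$. A commutative Hom-associative algebra $(A,\cdot,\alpha)$ is a vector space $A$ with a bilinear product $\cdot$ and a linear map $\alpha:A\to A$ with $x\cdot y=y\cdot x$ and $\alpha(x)\cdot(y\cdot z)=(x\cdot y)\cdot\alpha(z)$. A Hom-Lie algebra $(A,\{\cdot,\cdot\},\alpha)$ is a vector space with a skew-symmetric bilinear bracket and a linear map $\alpha$ with $\{\alpha(x),\{y,z\}\}+\{\alpha(y),\{z,x\}\}+\{\alpha(z),\{x,y\}\}=0$. A transposed Hom-Poisson algebra $(A,\cdot,\{\cdot,\cdot\},\alpha)$ consists of a commutative Hom-associative algebra $(A,\cdot,\alpha)$ and a Hom-Lie algebra $(A,\{\cdot,\cdot\},\alpha)$ such that $2\alpha(z)\cdot\{x,y\}=\{z\cdot x,\alpha(y)\}+\{\alpha(x),z\cdot y\}$ for all $x,y,z$. A Hom-pre-Lie algebra $(A,\ast,\alpha)$ is a vector space with bilinear product $\ast$ and linear map $\alpha$ with $(x\ast y)\ast\alpha(z)-\alpha(x)\ast(y\ast z)=(y\ast x)\ast\alpha(z)-\alpha(y)\ast(x\ast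 z)$. A Hom-pre-Lie Poisson algebra $(A,\cdot,\ast,\alpha)$ consists of a commutative Hom-associative algebra $(A,\cdot,\alpha)$ and a Hom-pre-Lie algebra $(A,\ast,\alpha)$ such that for all $x,y,z\in A$: $(x\cdot y)\ast\alpha(z)=\alpha(x)\cdot(y\ast z)$ and $(x\ast y)\cdot\alpha(z)-(y\ast x)\cdot\alpha(z)=\alpha(x)\ast(y\cdot z)-\alpha(y)\ast(x\cdot z)$. *)

theory Defs
  imports Complex_Main "HOL-Computational_Algebra.Polynomial"
begin

text \<open>
  An algebra lives on a whole type \<open>'v\<close>, made into a vector space over the field \<open>'k\<close> by the
  scalar multiplication \<open>scale\<close> of the locale \<^locale>\<open>vector_space\<close>. No finite-dimensionality is
  assumed, and \<open>\<alpha>\<close> is only linear: it need not be multiplicative for any of the products.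
\<close>

locale vector_space_bilinear = vector_space scale
  for scale :: "'k::field \<Rightarrow> 'v::ab_group_add \<Rightarrow> 'v" +
  fixes prod :: "'v \<Rightarrow> 'v \<Rightarrow> 'v"
  assumes linear_left: "Vector_Spaces.linear scale scale (\<lambda>x. prod x y)"
    and linear_right: "Vector_Spaces.linear scale scale (\<lambda>y. prod x y)"

locale comm_hom_assoc_algebra = vector_space_bilinear scale mult
  for scale :: "'k::field \<Rightarrow> 'v::ab_group_add \<Rightarrow> 'v"
    and mult :: "'v \<Rightarrow> 'v \<Rightarrow> 'v"  (infixl \<open>\<cdot>\<close> 70) +
  fixes \<alpha> :: "'v \<Rightarrow> 'v"
  assumes linear_twist: "Vector_Spaces.linear scale scale \<alpha>"
    and mult_commute: "x \<cdot> y = y \<cdot> x"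
    and hom_assoc: "\<alpha> x \<cdot> (y \<cdot> z) = (x \<cdot> y) \<cdot> \<alpha> z"

locale hom_lie_algebra = vector_space_bilinear scale bracket
  for scale :: "'k::field \<Rightarrow> 'v::ab_group_add \<Rightarrow> 'v"
    and bracket :: "'v \<Rightarrow> 'v \<Rightarrow> 'v" +
  fixes \<alpha> :: "'v \<Rightarrow> 'v"
  assumes linear_twist: "Vector_Spaces.linear scale scale \<alpha>"
    and skew_symmetric: "bracket x y = - bracket y x"
    and hom_jacobi:
      "bracket (\<alpha> x) (bracket y z) + bracket (\<alpha> y) (bracket z x) + bracket (\<alpha> z) (bracket x y) = 0"

locale transposed_hom_poisson_algebra =
  comm_hom_assoc: comm_hom_assoc_algebra scale mult \<alpha> +
  hom_lie: hom_lie_algebra scale bracket \<alpha>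
  for scale :: "'k::field \<Rightarrow> 'v::ab_group_add \<Rightarrow> 'v"
    and mult :: "'v \<Rightarrow> 'v \<Rightarrow> 'v"  (infixl \<open>\<cdot>\<close> 70)
    and bracket :: "'v \<Rightarrow> 'v \<Rightarrow> 'v"
    and \<alpha> :: "'v \<Rightarrow> 'v" +
  assumes transposed_hom_leibniz:
    "scale 2 (\<alpha> z \<cdot> bracket x y) = bracket (z \<cdot> x) (\<alpha> y) + bracket (\<alpha> x) (z \<cdot> y)"

locale hom_pre_lie_algebra = vector_space_bilinear scale star
  for scale :: "'k::field \<Rightarrow> 'v::ab_group_add \<Rightarrow> 'v"
    and star :: "'v \<Rightarrow> 'v \<Rightarrow> 'v"  (infixl \<open>\<star>\<close> 70) +
  fixes \<alpha> :: "'v \<Rightarrow> 'v"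
  assumes linear_twist: "Vector_Spaces.linear scale scale \<alpha>"
    and hom_pre_lie:
      "(x \<star> y) \<star> \<alpha> z - \<alpha> x \<star> (y \<star> z) = (y \<star> x) \<star> \<alpha> z - \<alpha> y \<star> (x \<star> z)"

locale hom_pre_lie_poisson_algebra =
  comm_hom_assoc: comm_hom_assoc_algebra scale mult \<alpha> +
  hom_pre_lie: hom_pre_lie_algebra scale star \<alpha>
  for scale :: "'k::field \<Rightarrow> 'v::ab_group_add \<Rightarrow> 'v"
    and mult :: "'v \<Rightarrow> 'v \<Rightarrow> 'v"  (infixl \<open>\<cdot>\<close> 70)
    and star :: "'v \<Rightarrow> 'v \<Rightarrow> 'v"  (infixl \<open>\<star>\<close> 70)
    and \<alpha> :: "'v \<Rightarrow> 'v" +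
  assumes mult_star: "(x \<cdot> y) \<star> \<alpha> z = \<alpha> x \<cdot> (y \<star> z)"
    and star_mult:
      "(x \<star> y) \<cdot> \<alpha> z - (y \<star> x) \<cdot> \<alpha> z = \<alpha> x \<star> (y \<cdot> z) - \<alpha> y \<star> (x \<cdot> z)"

end

theory Submission
  imports Defs
begin

text \<open>
  The commutator of a Hom-pre-Lie product is a Hom-Lie bracket for the same reason as in the
  untwisted case: the Hom-pre-Lie identity says that the twisted associator
  \<open>(x \<star> y) \<star> \<alpha> z - \<alpha> x \<star> (y \<star> z)\<close> is symmetric in \<open>x\<close> and \<open>y\<close>, and the cyclic sum in the
  Hom-Jacobi identity is an alternating sum of these associators, which therefore cancel in pairs
  (\<open>commutator_hom_lie\<close>).

  For the transposed Leibniz rule, the four terms of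
  \<open>{z \<cdot> x, \<alpha> y} + {\<alpha> x, z \<cdot> y}\<close> split into two pairs. In the pair
  \<open>(z \<cdot> x) \<star> \<alpha> y - (z \<cdot> y) \<star> \<alpha> x\<close> the first compatibility condition pulls out \<open>\<alpha> z\<close>, and in the pair
  \<open>\<alpha> x \<star> (z \<cdot> y) - \<alpha> y \<star> (z \<cdot> x)\<close> the second one does. Each pair contributes one copy of
  \<open>\<alpha> z \<cdot> {x, y}\<close>, which is the origin of the factor 2
  (\<open>commutator_transposed_leibniz\<close>).
\<close>

lemma (in vector_space_bilinear) commutator_bilinear:
  "vector_space_bilinear scale (\<lambda>x y. prod x y - prod y x)"
proof (intro vector_space_bilinear.intro vector_space_bilinear_axioms.intro)
  have pair: "vector_space_pair scale scale"
    by unfold_locales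
  show "vector_space scale"
    by unfold_locales
  show "Vector_Spaces.linear scale scale (\<lambda>x. prod x y - prod y x)" for y
    using linear_left linear_right by (rule vector_space_pair.linear_compose_sub[OF pair])
  show "Vector_Spaces.linear scale scale (\<lambda>y. prod x y - prod y x)" for x
    using linear_right linear_left by (rule vector_space_pair.linear_compose_sub[OF pair])
qed

lemma (in vector_space_bilinear) diff_left: "prod (x - y) z = prod x z - prod y z"
  using linear_left by (rule module_hom.diff[OF Vector_Spaces.linear.axioms(3)])

lemma (in vector_space_bilinear) diff_right: "prod z (x - y) = prod z x - prod z y"
  using linear_right by (rule module_hom.diff[OF Vector_Spaces.linear.axioms(3)])

text \<open>
  Read with \<open>[a, b] = a \<star> b - b \<star> a\<close>, the Hom-pre-Lie identity says that left multiplication is a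
  twisted representation of the commutator:
  \<open>[a, b] \<star> \<alpha> c = \<alpha> a \<star> (b \<star> c) - \<alpha> b \<star> (a \<star> c)\<close>. Substituting this in the Hom-Jacobi sum leaves
  only terms of the shape \<open>\<alpha> u \<star> (v \<star> w)\<close>, each occurring once with either sign.
\<close>
lemma (in hom_pre_lie_algebra) commutator_hom_lie:
  "hom_lie_algebra scale (\<lambda>x y. x \<star> y - y \<star> x) \<alpha>"
proof (intro hom_lie_algebra.intro hom_lie_algebra_axioms.intro)
  show "vector_space_bilinear scale (\<lambda>x y. x \<star> y - y \<star> x)"
    by (rule commutator_bilinear)
  show "Vector_Spaces.linear scale scale \<alpha>"
    by (rule linear_twist)
  show "x \<star> y - y \<star> x = - (y \<star> x - x \<star> y)" for x y
    by simp
  have twisted_representation: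
    "(a \<star> b - b \<star> a) \<star> \<alpha> c = \<alpha> a \<star> (b \<star> c) - \<alpha> b \<star> (a \<star> c)" for a b c
    using hom_pre_lie[of a b c] by (simp add: diff_left algebra_simps)
  show "(\<alpha> x \<star> (y \<star> z - z \<star> y) - (y \<star> z - z \<star> y) \<star> \<alpha> x)
      + (\<alpha> y \<star> (z \<star> x - x \<star> z) - (z \<star> x - x \<star> z) \<star> \<alpha> y)
      + (\<alpha> z \<star> (x \<star> y - y \<star> x) - (x \<star> y - y \<star> x) \<star> \<alpha> z) = 0" for x y z
    unfolding twisted_representation by (simp add: diff_right)
qed

text \<open>
  The four terms are regrouped by the side on which \<open>\<alpha>\<close> stands: with \<open>\<alpha>\<close> on the right of \<open>\<star>\<close> the
  condition \<open>mult_star\<close> applies to each term separately, with \<open>\<alpha>\<close> on the left only the difference of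
  the two terms is known, from \<open>star_mult\<close> and commutativity.
\<close>
lemma (in hom_pre_lie_poisson_algebra) commutator_transposed_leibniz:
  "scale 2 (\<alpha> z \<cdot> (x \<star> y - y \<star> x))
    = ((z \<cdot> x) \<star> \<alpha> y - \<alpha> y \<star> (z \<cdot> x)) + (\<alpha> x \<star> (z \<cdot> y) - (z \<cdot> y) \<star> \<alpha> x)"
proof -
  have twist_right: "(z \<cdot> x) \<star> \<alpha> y - (z \<cdot> y) \<star> \<alpha> x = \<alpha> z \<cdot> (x \<star> y - y \<star> x)"
    by (simp add: mult_star comm_hom_assoc.diff_right)
  have "\<alpha> x \<star> (z \<cdot> y) - \<alpha> y \<star> (z \<cdot> x) = (x \<star> y) \<cdot> \<alpha> z - (y \<star> x) \<cdot> \<alpha> z"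
    by (simp add: star_mult comm_hom_assoc.mult_commute[of z])
  also have "\<dots> = \<alpha> z \<cdot> (x \<star> y - y \<star> x)"
    by (simp add: comm_hom_assoc.diff_right comm_hom_assoc.mult_commute[of "\<alpha> z"])
  finally have twist_left: "\<alpha> x \<star> (z \<cdot> y) - \<alpha> y \<star> (z \<cdot> x) = \<alpha> z \<cdot> (x \<star> y - y \<star> x)" .
  have double: "scale 2 v = v + v" for v
    using comm_hom_assoc.scale_left_distrib[of 1 1 v] by simp
  have "scale 2 (\<alpha> z \<cdot> (x \<star> y - y \<star> x))
      = ((z \<cdot> x) \<star> \<alpha> y - (z \<cdot> y) \<star> \<alpha> x) + (\<alpha> x \<star> (z \<cdot> y) - \<alpha> y \<star> (z \<cdot> x))"
    unfolding twist_right twist_left by (rule double)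
  then show ?thesis
    by (simp add: algebra_simps)
qed

theorem theorem4p15:
  fixes scale :: "'k::{alg_closed_field, field_char_0} \<Rightarrow> 'v::ab_group_add \<Rightarrow> 'v"
    and mult star :: "'v \<Rightarrow> 'v \<Rightarrow> 'v"
    and \<alpha> :: "'v \<Rightarrow> 'v"
  assumes "hom_pre_lie_poisson_algebra scale mult star \<alpha>"
  shows "transposed_hom_poisson_algebra scale mult (\<lambda>x y. star x y - star y x) \<alpha>"
proof -
  interpret hom_pre_lie_poisson_algebra scale mult star \<alpha>
    by (rule assms)
  interpret commutator: hom_lie_algebra scale "\<lambda>x y. star x y - star y x" \<alpha>
    by (rule hom_pre_lie.commutator_hom_lie)
  show ?thesis
    by unfold_locales (rule commutator_transposed_leibniz)
qed

end
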